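(* Let $K$ be a field of characteristic zero and $\mathcal{A}$ a finite dimensional $K$-algebra. Then: (i) for every locally finite $K$-derivation and every locally finite $K$-$\mathcal{E}$-derivation $\delta$ of $\mathcal{A}$, the image $\operatorname{Im}\delta=\delta(\mathcal{A})$ is a Mathieu subspace of $\mathcal{A}$; (ii) every locally nilpotent $K$-derivation and every locally nilpotent $K$-$\mathcal{E}$-derivation $\delta$ of $\mathcal{A}$ maps every $\vartheta$-ideal of $\mathcal{A}$ to a $\vartheta$-Mathieu subspace of $\mathcal{A}$, for each $\vartheta\in\{\text{left},\text{right},\text{two-sided}\}$.
   Context: Algebras are associative, not necessarily commutative. A $K$-linear endomorphism $\eta$ of $\mathcal{A}$ is locally nilpotent if for each $a\in\mathcal{A}$ there is $m\ge1$ with $\eta^m(a)=0$, and locally finite if for each $a\in\mathcal{A}$ the $K$-subspace spanned by $\eta^i(a)$ $(i\ge 0)$ is finite dimensional. A $K$-derivation of $\mathcal{A}$ is a $K$-linear map $D:\mathcal{A}\to\mathcal{A}$ with $D(ab)=D(a)b+aD(b)$ for all $a,b$. A $K$-$\mathcal{E}$-derivation of $\mathcal{A}$ is a $K$-linear map $\delta:\mathcal{A}\to\mathcal{A}$ with $\delta(ab)=\delta(a)b+a\delta(b)-\delta(a)\delta(b)$ for all $a,b$; equivalently, $\delta=\mathrm{I}-\phi$, where $\mathrm{I}$ is the identity map and $\phi$ is a $K$-algebra endomorphism of $\mathcal{A}$ (a $K$-linear multiplicative map, not required to preserve an identity element). A $K$-subspace $V$ of $\mathcal{A}$ is a $\vartheta$-Mathieu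 subspace of $\mathcal{A}$ if for all $a,b,c\in\mathcal{A}$ with $a^m\in V$ for all $m\ge1$: (left) $ba^m\in V$ for all sufficiently large $m$, if $\vartheta=$ left; (right) $a^mc\in V$ for all sufficiently large $m$, if $\vartheta=$ right; (two-sided) $ba^mc\in V$ for all sufficiently large $m$, if $\vartheta=$ two-sided. A "Mathieu subspace" means a two-sided Mathieu subspace. *)

theory Defs
  imports Complex_Main
begin

text \<open>
  Associative algebras over a field, with or without an identity element: the carrier is a type of
  class \<open>ring\<close> (no unit, no commutativity) and \<open>scale\<close> is the scalar action.
\<close>

locale algebra_over = vector_space scale
  for scale :: "'k::field \<Rightarrow> 'a::ring \<Rightarrow> 'a" (infixr \<open>*s\<close> 75) +
  assumes scale_mult_left: "(r *s x) * y = r *s (x * y)"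
    and scale_mult_right: "x * (r *s y) = r *s (x * y)"

definition findim :: "('k::field \<Rightarrow> 'a::ring \<Rightarrow> 'a) \<Rightarrow> 'a set \<Rightarrow> bool" where
  "findim scale V \<longleftrightarrow> (\<exists>B. finite B \<and> B \<subseteq> V \<and> V = module.span scale B)"

text \<open>Since there need not be an identity element, \<open>ring_pow a m\<close> is the usual power of \<open>a\<close> only for
  \<open>m \<ge> 1\<close>; the value at \<open>m = 0\<close> is junk (equal to \<open>a\<close>) and must not be used.\<close>

definition ring_pow :: "'a::ring \<Rightarrow> nat \<Rightarrow> 'a" where
  "ring_pow a m = ((\<lambda>x. x * a) ^^ (m - 1)) a"

lemma ring_pow_1: "ring_pow a 1 = a"
  by (simp add: ring_pow_def)

lemma ring_pow_Suc: "m \<ge> 1 \<Longrightarrow> ring_pow a (Suc m) = ring_pow a m * a"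
  by (cases m) (simp_all add: ring_pow_def)

lemma ring_pow_eq_power:
  fixes a :: "'a::ring_1"
  shows "m \<ge> 1 \<Longrightarrow> ring_pow a m = a ^ m"
  by (induction m rule: dec_induct) (simp_all add: ring_pow_1 ring_pow_Suc power_commutes del: One_nat_def)

definition locally_nilpotent :: "('a::ring \<Rightarrow> 'a) \<Rightarrow> bool" where
  "locally_nilpotent \<eta> \<longleftrightarrow> (\<forall>a. \<exists>m\<ge>1. (\<eta> ^^ m) a = 0)"

definition locally_finite :: "('k::field \<Rightarrow> 'a::ring \<Rightarrow> 'a) \<Rightarrow> ('a \<Rightarrow> 'a) \<Rightarrow> bool" where
  "locally_finite scale \<eta> \<longleftrightarrow>
     (\<forall>a. findim scale (module.span scale (range (\<lambda>i. (\<eta> ^^ i) a))))"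

definition derivation :: "('k::field \<Rightarrow> 'a::ring \<Rightarrow> 'a) \<Rightarrow> ('a \<Rightarrow> 'a) \<Rightarrow> bool" where
  "derivation scale D \<longleftrightarrow>
     Vector_Spaces.linear scale scale D \<and> (\<forall>a b. D (a * b) = D a * b + a * D b)"

definition E_derivation :: "('k::field \<Rightarrow> 'a::ring \<Rightarrow> 'a) \<Rightarrow> ('a \<Rightarrow> 'a) \<Rightarrow> bool" where
  "E_derivation scale \<delta> \<longleftrightarrow>
     Vector_Spaces.linear scale scale \<delta> \<and>
     (\<forall>a b. \<delta> (a * b) = \<delta> a * b + a * \<delta> b - \<delta> a * \<delta> b)"

datatype side = Left_Sided | Right_Sided | Two_Sided

text \<open>Ideals of an algebra are linear subspaces; without an identity element this does not follow
  from closure under multiplication.\<close>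

definition sided_ideal ::
  "('k::field \<Rightarrow> 'a::ring \<Rightarrow> 'a) \<Rightarrow> side \<Rightarrow> 'a set \<Rightarrow> bool" where
  "sided_ideal scale \<theta> J \<longleftrightarrow> module.subspace scale J \<and>
     (case \<theta> of
        Left_Sided \<Rightarrow> (\<forall>b. \<forall>x\<in>J. b * x \<in> J)
      | Right_Sided \<Rightarrow> (\<forall>x\<in>J. \<forall>c. x * c \<in> J)
      | Two_Sided \<Rightarrow> (\<forall>b. \<forall>x\<in>J. b * x \<in> J) \<and> (\<forall>x\<in>J. \<forall>c. x * c \<in> J))"

definition mathieu_subspace ::
  "('k::field \<Rightarrow> 'a::ring \<Rightarrow> 'a) \<Rightarrow> side \<Rightarrow> 'a set \<Rightarrow> bool" where
  "mathieu_subspace scale \<theta> V \<longleftrightarrow> module.subspace scale V \<and>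
     (\<forall>a b c. (\<forall>m\<ge>1. ring_pow a m \<in> V) \<longrightarrow>
       (case \<theta> of
          Left_Sided \<Rightarrow> (\<forall>\<^sub>F m in sequentially. b * ring_pow a m \<in> V)
        | Right_Sided \<Rightarrow> (\<forall>\<^sub>F m in sequentially. ring_pow a m * c \<in> V)
        | Two_Sided \<Rightarrow> (\<forall>\<^sub>F m in sequentially. b * ring_pow a m * c \<in> V)))"

end

theory Submission
  imports Defs
begin

text \<open>
  Both parts come down to locating the idempotents in the image of \<open>\<delta>\<close>. In a finite-dimensional
  algebra the span of the powers \<open>a, a\<^sup>2, \<dots>\<close> contains an idempotent \<open>e\<close> that acts as an identity
  on all high powers of \<open>a\<close> (lemma \<open>powers_eventual_unit\<close>). If all powers of \<open>a\<close> lie in a subspace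
  \<open>V\<close>, then so does \<open>e\<close>, and the high powers of \<open>a\<close> lie in every two-sided ideal that contains
  \<open>e\<close>. Hence \<open>V\<close> is a Mathieu subspace, for all three sides at once, as soon as its idempotents are
  contained in a two-sided ideal \<open>I \<subseteq> V\<close> (lemma \<open>mathieu_subspace_if_idempotents_in_ideal\<close>).

  Idempotents in images are controlled by a trace. In characteristic zero a linear idempotent of
  trace zero vanishes, because its trace is its rank; so an idempotent operator that is a commutator
  vanishes (lemma \<open>idempotent_commutator_eq_0\<close>).

  For a derivation \<open>D\<close>, the Leibniz rule says that left multiplication by \<open>D x\<close> is the commutator
  of \<open>D\<close> with left multiplication by \<open>x\<close>. If \<open>e = D x\<close> is idempotent, then left multiplication
  by \<open>e\<close> is zero and \<open>e = e * e = 0\<close>. So every subspace of the image of \<open>D\<close> is a Mathieu subspace,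
  with \<open>I = 0\<close>.

  For an \<open>\<E>\<close>-derivation \<open>\<delta>\<close>, the map \<open>\<phi> = id - \<delta>\<close> is a multiplicative endomorphism. If \<open>\<phi>\<close> is
  bijective with inverse \<open>\<psi>\<close> and \<open>e = x - \<phi> x\<close> is idempotent, then left multiplication by \<open>e\<close> is
  the commutator of \<open>y \<mapsto> x * \<psi> y\<close> with \<open>\<phi>\<close>, and again \<open>e = 0\<close>. In general \<open>\<phi>\<close> is bijective on the
  subalgebra \<open>range (\<phi> ^^ N)\<close> for large \<open>N\<close> (Fitting). The element \<open>(\<phi> ^^ N) e\<close> of this subalgebra
  is again an idempotent of the form \<open>x' - \<phi> x'\<close>, so it vanishes. Thus the idempotents of the image
  of \<open>\<delta>\<close> lie in the ideal \<open>I\<close> of all \<open>y\<close> with \<open>(\<phi> ^^ N) y = 0\<close>, and this ideal is contained in the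
  image, since \<open>y - (\<phi> ^^ N) y\<close> is in the image for every \<open>y\<close>.

  If the \<open>\<E>\<close>-derivation \<open>\<delta>\<close> is locally nilpotent, then \<open>\<phi>\<close> is injective, so \<open>N = 0\<close> will do and
  \<open>I = 0\<close>. The image of \<open>\<delta>\<close> then has no idempotent except zero, and \<open>\<delta>\<close> maps ideals, being
  subspaces, to Mathieu subspaces.
\<close>

section \<open>The trace of a commutator\<close>

locale findim_vector_space_char_0 = finite_dimensional_vector_space scale Basis
  for scale :: "'a::field_char_0 \<Rightarrow> 'b::ab_group_add \<Rightarrow> 'b" (infixr \<open>*s\<close> 75)
    and Basis :: "'b set"
begin

sublocale pair: finite_dimensional_vector_space_pair scale Basis scale Basis
  by unfold_locales

text \<open>
  This is the trace of the restriction of \<open>f\<close> to the span of \<open>B\<close> if \<open>f\<close> maps this span to itself;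
  otherwise it means nothing, since \<open>representation B\<close> is zero by default outside the span.
\<close>

definition basis_trace :: "'b set \<Rightarrow> ('b \<Rightarrow> 'b) \<Rightarrow> 'a" where
  "basis_trace B f = (\<Sum>b\<in>B. representation B (f b) b)"

lemma basis_trace_comp_commute:
  assumes B: "independent B"
    and f: "Vector_Spaces.linear scale scale f" "f ` span B \<subseteq> span B"
    and g: "Vector_Spaces.linear scale scale g" "g ` span B \<subseteq> span B"
  shows "basis_trace B (\<lambda>v. f (g v)) = basis_trace B (\<lambda>v. g (f v))"
proof -
  have fin: "finite B" using B by (rule finiteI_independent)
  have expand: "basis_trace B (\<lambda>v. h (k v)) =
      (\<Sum>b\<in>B. \<Sum>c\<in>B. representation B (k b) c * representation B (h c) b)"
    if h: "Vector_Spaces.linear scale scale h" "h ` span B \<subseteq> span B"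
      and k: "k ` span B \<subseteq> span B" for h k
    unfolding basis_trace_def
  proof (rule sum.cong[OF refl])
    fix b assume b: "b \<in> B"
    interpret h: Vector_Spaces.linear scale scale h by (rule h(1))
    have kb: "k b \<in> span B" using k b by (auto intro: span_base)
    have hc: "h c \<in> span B" if "c \<in> B" for c using h(2) that by (auto intro: span_base)
    have "h (k b) = h (\<Sum>c\<in>B. representation B (k b) c *s c)"
      using B fin kb by (simp add: sum_representation_eq)
    also have "\<dots> = (\<Sum>c\<in>B. representation B (k b) c *s h c)"
      by (simp add: h.sum h.scale)
    finally show "representation B (h (k b)) b =
        (\<Sum>c\<in>B. representation B (k b) c * representation B (h c) b)"
      using B hc by (simp add: representation_sum representation_scale span_scale)
  qed
  show ?thesis
    unfolding expand[OF f g(2)] expand[OF g f(2)]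
    by (subst sum.swap) (simp add: mult.commute)
qed

text \<open>
  The trace of \<open>P\<close> on \<open>S\<close> is zero because \<open>P\<close> is a commutator there. It also equals the rank of
  \<open>P\<close>, which is visible in a basis of \<open>S\<close> that extends a basis of the image; in characteristic zero
  the rank is therefore zero.
\<close>

lemma idempotent_commutator_eq_0:
  assumes S: "subspace S"
    and f: "Vector_Spaces.linear scale scale f" "f ` S \<subseteq> S"
    and g: "Vector_Spaces.linear scale scale g" "g ` S \<subseteq> S"
    and P: "\<And>v. v \<in> S \<Longrightarrow> P v = f (g v) - g (f v)"
    and idem: "\<And>v. v \<in> S \<Longrightarrow> P (P v) = P v"
    and v: "v \<in> S"
  shows "P v = 0"
proof -
  obtain B1 where B1: "B1 \<subseteq> P ` S" "independent B1" "P ` S \<subseteq> span B1"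
    using maximal_independent_subset[of "P ` S"] by blast
  have PS: "P ` S \<subseteq> S"
    using f(2) g(2) subspace_diff[OF S] P by (auto simp: image_subset_iff)
  obtain B where B: "B1 \<subseteq> B" "B \<subseteq> S" "independent B" "S \<subseteq> span B"
    using maximal_independent_subset_extend[OF subset_trans[OF B1(1) PS] B1(2)] .
  have fin: "finite B"
    using B(3) by (rule finiteI_independent)
  have span_B: "span B = S"
    using B(2,4) S by (simp add: span_minimal subset_antisym)
  \<comment> \<open>A basis vector in \<open>B1\<close> is fixed by \<open>P\<close>; any other is mapped into the span of \<open>B1\<close>, so its
    diagonal entry is zero.\<close>
  have diag: "representation B (P b) b = (if b \<in> B1 then 1 else 0)" if b: "b \<in> B" for b
  proof (cases "b \<in> B1")
    case True
    then have "P b = b" using B1(1) idem by blast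
    then show ?thesis using True b B(3) by (simp add: representation_basis)
  next
    case False
    have "P b \<in> span B1" using b B(2) B1(3) by auto
    then have "representation B (P b) = representation B1 (P b)"
      by (rule representation_extend[OF B(3) _ B(1)])
    then show ?thesis using False representation_ne_zero[of B1 "P b" b] by auto
  qed
  have fgS: "f (g b) \<in> S" "g (f b) \<in> S" if "b \<in> B" for b
    using subsetD[OF B(2) that] f(2) g(2) by (simp_all add: image_subset_iff)
  have "of_nat (card B1) = basis_trace B P"
    using fin B(1) by (simp add: basis_trace_def diag sum.If_cases Int_absorb1)
  also have "\<dots> = basis_trace B (\<lambda>v. f (g v)) - basis_trace B (\<lambda>v. g (f v))"
    unfolding basis_trace_def sum_subtractf[symmetric]
  proof (rule sum.cong[OF refl])
    fix b assume b: "b \<in> B"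
    then show "representation B (P b) b =
        representation B (f (g b)) b - representation B (g (f b)) b"
      using P[of b] B(2) fgS[OF b] representation_diff[OF B(3)] span_B by auto
  qed
  also have "\<dots> = 0"
    using basis_trace_comp_commute[OF B(3)] f g span_B by simp
  finally have "B1 = {}"
    using finite_subset[OF B(1) fin] by simp
  then show ?thesis using B1(3) v by auto
qed

end

section \<open>Finite-dimensional algebras in characteristic zero\<close>

lemma ring_pow_add:
  assumes m: "m \<ge> 1" and n: "n \<ge> 1"
  shows "ring_pow a (m + n) = ring_pow a m * ring_pow a n"
  using n
proof (induction n rule: dec_induct)
  case base
  show ?case using ring_pow_Suc[OF m, of a] ring_pow_1[of a] by simp
next
  case (step k)
  then show ?case using m by (simp add: ring_pow_Suc mult.assoc)
qed

locale findim_algebra = algebra_over scale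
  for scale :: "'k::field_char_0 \<Rightarrow> 'a::ring \<Rightarrow> 'a" (infixr \<open>*s\<close> 75) +
  assumes findim_UNIV: "findim scale UNIV"
begin

text \<open>
  Some basis has to be named to enter the finite-dimensional vector space theory; extending the empty
  set to a basis provides one.
\<close>

sublocale findim_vector_space_char_0 scale "extend_basis {}"
proof
  obtain C where C: "finite C" "span C = UNIV"
    using findim_UNIV by (auto simp: findim_def)
  show "independent (extend_basis {})"
    by (simp add: independent_extend_basis independent_empty)
  then show "finite (extend_basis {})"
    using independent_span_bound[OF C(1)] C(2) by blast
  show "span (extend_basis {}) = UNIV"
    by (simp add: independent_empty)
qed

lemma linear_mult_left: "Vector_Spaces.linear scale scale (\<lambda>y. x * y)"
  by unfold_locales (simp_all add: distrib_left scale_mult_right)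

section \<open>Idempotents in the image\<close>

text \<open>
  The Leibniz rule makes left multiplication by \<open>D x\<close> a commutator, so it vanishes when \<open>D x\<close> is
  idempotent.
\<close>

lemma derivation_idempotent_in_range_eq_0:
  assumes D: "derivation scale D" and e: "e \<in> range D" "e * e = e"
  shows "e = 0"
proof -
  obtain x where x: "e = D x" using e(1) by blast
  have "e * e = 0"
  proof (rule idempotent_commutator_eq_0[where S = UNIV and f = D and g = "\<lambda>y. x * y" and P = "\<lambda>y. e * y"])
    show "Vector_Spaces.linear scale scale D" using D by (simp add: derivation_def)
    show "Vector_Spaces.linear scale scale (\<lambda>y. x * y)" by (rule linear_mult_left)
    show "e * v = D (x * v) - x * D v" for v
      using D by (simp add: derivation_def x)
    show "e * (e * v) = e * v" for v
      by (simp add: e(2) flip: mult.assoc)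
  qed simp_all
  then show ?thesis using e(2) by simp
qed

lemma linear_funpow:
  assumes "Vector_Spaces.linear scale scale f"
  shows "Vector_Spaces.linear scale scale (f ^^ n)"
proof (induction n)
  case 0
  show ?case using linear_id by (simp add: id_def)
next
  case (Suc n)
  then show ?case using Vector_Spaces.linear_compose[OF Suc assms] by (simp add: o_def)
qed

text \<open>
  The kernels of the powers of \<open>f\<close> increase, so they are constant from the first one of largest
  dimension on.
\<close>

lemma kernel_funpow_stabilizes:
  assumes f: "Vector_Spaces.linear scale scale f"
  obtains N where "\<And>y. (f ^^ Suc N) y = 0 \<Longrightarrow> (f ^^ N) y = 0"
proof -
  interpret f: Vector_Spaces.linear scale scale f by (rule f)
  let ?K = "\<lambda>n. {y. (f ^^ n) y = 0}"
  have sub: "subspace (?K n)" for n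
    using linear_funpow[OF f, of n] by (rule pair.linear_subspace_kernel)
  obtain N where N: "dim (?K n) \<le> dim (?K N)" for n
    using ex_has_greatest_nat[of "\<lambda>_. True" 0 "\<lambda>n. dim (?K n)" "Suc dimension"] dim_subset_UNIV
    by (auto simp: less_Suc_eq_le)
  have "?K N \<subseteq> ?K (Suc N)"
    by (auto simp: f.zero)
  then have "?K N = ?K (Suc N)"
    by (rule subspace_dim_equal[OF sub sub _ N])
  then show ?thesis using that by blast
qed

text \<open>
  Injectivity on the finite-dimensional \<open>S\<close> makes \<open>\<phi>\<close> bijective there. With \<open>\<psi>\<close> its inverse on
  \<open>S\<close>, \<open>\<phi> x * y = \<phi> (x * \<psi> y)\<close> and \<open>x * y = x * \<psi> (\<phi> y)\<close>, so left multiplication by \<open>x - \<phi> x\<close>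
  is a commutator on \<open>S\<close>.
\<close>

lemma idempotent_difference_eq_0:
  assumes lin: "Vector_Spaces.linear scale scale \<phi>" and mult: "\<And>a b. \<phi> (a * b) = \<phi> a * \<phi> b"
    and S: "subspace S" "\<And>a b. a \<in> S \<Longrightarrow> b \<in> S \<Longrightarrow> a * b \<in> S"
    and \<phi>: "\<phi> ` S \<subseteq> S" "inj_on \<phi> S"
    and x: "x \<in> S" and e: "e = x - \<phi> x" "e * e = e"
  shows "e = 0"
proof -
  obtain \<psi> where \<psi>: "range \<psi> \<subseteq> S" "Vector_Spaces.linear scale scale \<psi>" "\<And>v. v \<in> S \<Longrightarrow> \<psi> (\<phi> v) = v"
    using pair.linear_exists_left_inverse_on[OF lin S(1) \<phi>(2)] by blast
  have span_S: "span S = S" using S(1) by (simp add: span_eq_iff)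
  have "subspace (\<phi> ` S)" using lin S(1) by (rule pair.linear_subspace_image)
  moreover have "dim S \<le> dim (\<phi> ` S)"
    using pair.dim_image_eq[OF lin, of S] \<phi>(2) span_S by simp
  ultimately have onto: "\<phi> ` S = S"
    using S(1) \<phi>(1) by (intro subspace_dim_equal)
  let ?g = "\<lambda>y. x * \<psi> y"
  have e_S: "e \<in> S" using e(1) x \<phi>(1) S(1) by (auto intro: subspace_diff)
  have "e * e = 0"
  proof (rule idempotent_commutator_eq_0[OF S(1) _ _ lin \<phi>(1) _ _ e_S, where P = "\<lambda>y. e * y"])
    show "Vector_Spaces.linear scale scale ?g"
      using Vector_Spaces.linear_compose[OF \<psi>(2) linear_mult_left[of x]] by (simp add: o_def)
    show "?g ` S \<subseteq> S" using x \<psi>(1) S(2) by blast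
    show "e * (e * v) = e * v" for v
      by (simp add: e(2) flip: mult.assoc)
    fix y assume y: "y \<in> S"
    then obtain v where v: "v \<in> S" "y = \<phi> v" using onto by blast
    have "e * y = x * y - \<phi> (x * v)"
      by (simp add: e(1) v(2) mult algebra_simps)
    then show "e * y = ?g (\<phi> y) - \<phi> (?g y)"
      using y v by (simp add: \<psi>(3))
  qed
  then show ?thesis using e(2) by simp
qed

lemma E_derivation_endomorphism:
  assumes "E_derivation scale \<delta>"
  defines "\<phi> \<equiv> \<lambda>y. y - \<delta> y"
  shows "Vector_Spaces.linear scale scale \<phi>" and "\<phi> (a * b) = \<phi> a * \<phi> b"
proof -
  show "Vector_Spaces.linear scale scale \<phi>"
    unfolding \<phi>_def using assms(1)
    by (intro pair.linear_compose_sub linear_ident) (simp add: E_derivation_def)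
  show "\<phi> (a * b) = \<phi> a * \<phi> b"
    using assms(1) by (simp add: E_derivation_def \<phi>_def algebra_simps)
qed

text \<open>
  The map \<open>\<phi> = id - \<delta>\<close> need not be injective, but by the choice of \<open>N\<close> it is injective on the
  subalgebra \<open>range (\<phi> ^^ N)\<close>, and \<open>\<phi> ^^ N\<close> carries the equation \<open>e = x - \<phi> x\<close> into this
  subalgebra.
\<close>

lemma E_derivation_idempotent_in_kernel_funpow:
  assumes \<delta>: "E_derivation scale \<delta>" and e: "e \<in> range \<delta>" "e * e = e"
    and N: "\<And>y. ((\<lambda>y. y - \<delta> y) ^^ Suc N) y = 0 \<Longrightarrow> ((\<lambda>y. y - \<delta> y) ^^ N) y = 0"
  shows "((\<lambda>y. y - \<delta> y) ^^ N) e = 0"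
proof -
  define \<phi> where "\<phi> = (\<lambda>y. y - \<delta> y)"
  have lin: "Vector_Spaces.linear scale scale \<phi>" and mult: "\<phi> (a * b) = \<phi> a * \<phi> b" for a b
    unfolding \<phi>_def by (fact E_derivation_endomorphism[OF \<delta>])+
  interpret \<phi>N: Vector_Spaces.linear scale scale "\<phi> ^^ N"
    by (rule linear_funpow[OF lin])
  have multN: "(\<phi> ^^ n) (a * b) = (\<phi> ^^ n) a * (\<phi> ^^ n) b" for n a b
    by (induction n) (simp_all add: mult)
  have comm: "(\<phi> ^^ N) (\<phi> y) = \<phi> ((\<phi> ^^ N) y)" for y
    by (rule funpow_swap1[symmetric])
  obtain x where x: "e = x - \<phi> x" using e(1) by (auto simp: \<phi>_def)
  have sub: "subspace (range (\<phi> ^^ N))"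
    using \<phi>N.linear_axioms subspace_UNIV by (rule pair.linear_subspace_image)
  have inj: "inj_on \<phi> (range (\<phi> ^^ N))"
    unfolding pair.linear_inj_on_iff_eq_0[OF lin sub]
  proof
    fix z assume "z \<in> range (\<phi> ^^ N)"
    then obtain y where y: "z = (\<phi> ^^ N) y" by blast
    have "(\<phi> ^^ Suc N) y = 0 \<Longrightarrow> (\<phi> ^^ N) y = 0"
      unfolding \<phi>_def by (rule N)
    then show "\<phi> z = 0 \<longrightarrow> z = 0" by (simp add: y)
  qed
  have "(\<phi> ^^ N) e = 0"
  proof (rule idempotent_difference_eq_0[OF lin mult sub _ _ inj])
    show "a * b \<in> range (\<phi> ^^ N)" if "a \<in> range (\<phi> ^^ N)" "b \<in> range (\<phi> ^^ N)" for a b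
      using that by (auto simp flip: multN)
    show "\<phi> ` range (\<phi> ^^ N) \<subseteq> range (\<phi> ^^ N)"
      by (auto simp flip: comm)
    show "(\<phi> ^^ N) x \<in> range (\<phi> ^^ N)" by simp
    show "(\<phi> ^^ N) e = (\<phi> ^^ N) x - \<phi> ((\<phi> ^^ N) x)"
      by (simp add: x \<phi>N.diff comm)
    show "(\<phi> ^^ N) e * (\<phi> ^^ N) e = (\<phi> ^^ N) e"
      by (simp add: e(2) flip: multN)
  qed
  then show ?thesis by (simp add: \<phi>_def)
qed

lemma kernel_funpow_ideal:
  assumes "E_derivation scale \<delta>"
  shows "sided_ideal scale Two_Sided {y. ((\<lambda>y. y - \<delta> y) ^^ N) y = 0}"
proof -
  note \<phi> = E_derivation_endomorphism[OF assms]
  have "((\<lambda>y. y - \<delta> y) ^^ n) (a * b) = ((\<lambda>y. y - \<delta> y) ^^ n) a * ((\<lambda>y. y - \<delta> y) ^^ n) b" for n a b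
    by (induction n) (simp_all only: funpow.simps id_apply o_apply \<phi>(2))
  then show ?thesis
    using pair.linear_subspace_kernel[OF linear_funpow[OF \<phi>(1)]] by (simp add: sided_ideal_def)
qed

text \<open>
  The difference \<open>y - \<phi>\<^sup>n y\<close>, with \<open>\<phi> = id - \<delta>\<close>, is the telescoping sum of the \<open>\<delta> (\<phi>\<^sup>i y)\<close> for
  \<open>i < n\<close>.
\<close>

lemma kernel_funpow_subset_range:
  assumes "E_derivation scale \<delta>"
  shows "{y. ((\<lambda>y. y - \<delta> y) ^^ N) y = 0} \<subseteq> range \<delta>"
proof -
  interpret \<delta>: Vector_Spaces.linear scale scale \<delta>
    using assms by (simp add: E_derivation_def)
  have "y - ((\<lambda>y. y - \<delta> y) ^^ n) y \<in> range \<delta>" for n y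
  proof (induction n)
    case 0
    show ?case by (auto intro!: image_eqI[of _ _ 0] simp: \<delta>.zero)
  next
    case (Suc n)
    let ?z = "((\<lambda>y. y - \<delta> y) ^^ n) y"
    have "(y - ?z) + \<delta> ?z \<in> range \<delta>"
      using Suc by (auto simp flip: \<delta>.add)
    then show ?case by (simp add: algebra_simps)
  qed
  from this[of _ N] show ?thesis
    by (metis (mono_tags, lifting) diff_zero mem_Collect_eq subsetI)
qed

section \<open>From idempotents to Mathieu subspaces\<close>

text \<open>
  Let \<open>W n\<close> be the span of the powers \<open>a\<^sup>m\<close> with \<open>m \<ge> n\<close>. For \<open>W n\<close> of least dimension,
  \<open>a\<^sup>n * W n = W (2 * n) = W n\<close> contains \<open>a\<^sup>n\<close>. So \<open>a\<^sup>n * e = a\<^sup>n\<close> for some \<open>e\<close> in \<open>W n\<close>, and then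
  \<open>w * e = w\<close> for all \<open>w\<close> in \<open>W n\<close>, among them \<open>e\<close> itself. As \<open>e\<close> is a combination of powers of
  \<open>a\<close>, it commutes with them and is an identity on the left as well.
\<close>

lemma powers_eventual_unit:
  fixes a :: 'a
  obtains e n where "e \<in> span (ring_pow a ` {1..})" "e * e = e"
    "\<And>m. m \<ge> n \<Longrightarrow> e * ring_pow a m = ring_pow a m"
proof -
  define W where "W n = span (ring_pow a ` {n..})" for n
  have sub: "subspace (W n)" for n by (simp add: W_def)
  have mono: "W m \<subseteq> W n" if "n \<le> m" for m n
    unfolding W_def using that by (intro span_mono) auto
  \<comment> \<open>The exponent 0 is excluded since \<open>ring_pow a 0\<close> is not a power of \<open>a\<close>.\<close>
  obtain n where n: "n \<ge> 1" "dim (W n) \<le> dim (W m)" if "m \<ge> 1" for m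
    using ex_has_least_nat[of "\<lambda>n. n \<ge> 1" 1 "\<lambda>n. dim (W n)"] by auto
  have n1: "n \<ge> 1" using n(1)[of 1] by simp
  have stable: "W (n + n) = W n"
    using n(2)[of "n + n"] n1 by (intro subspace_dim_equal sub mono) auto
  have "ring_pow a ` {n + n..} = (\<lambda>y. ring_pow a n * y) ` ring_pow a ` {n..}"
  proof -
    have "ring_pow a ` {n + n..} = (\<lambda>m. ring_pow a (n + m)) ` {n..}"
      by (simp flip: image_image[of "ring_pow a" "\<lambda>m. n + m"])
    also have "\<dots> = (\<lambda>y. ring_pow a n * y) ` ring_pow a ` {n..}"
      unfolding image_image using n1 by (intro image_cong refl ring_pow_add) auto
    finally show ?thesis .
  qed
  then have "W (n + n) = (\<lambda>y. ring_pow a n * y) ` W n"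
    unfolding W_def using pair.linear_span_image[OF linear_mult_left] by metis
  moreover have "ring_pow a n \<in> W n" unfolding W_def by (rule span_base) simp
  ultimately obtain e where e: "e \<in> W n" "ring_pow a n * e = ring_pow a n"
    using stable by (metis imageE)
  have right: "ring_pow a m * e = ring_pow a m" if "m \<ge> n" for m
  proof (cases "m = n")
    case False
    then have "ring_pow a m = ring_pow a (m - n) * ring_pow a n"
      using that n1 by (simp flip: ring_pow_add)
    then show ?thesis using e(2) by (simp add: mult.assoc)
  qed (use e(2) in simp)
  have comm: "w * ring_pow a m = ring_pow a m * w" if "w \<in> W n" "m \<ge> 1" for w m
    using that(1) unfolding W_def
  proof (induction rule: span_induct_alt)
    case (step c y z)
    then show ?case
      using n1 that(2)
      by (auto simp: distrib_left distrib_right scale_mult_left scale_mult_right ring_pow_add[symmetric] add.commute)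
  qed simp
  have "w * e = w" if "w \<in> W n" for w
    using that unfolding W_def
    by (induction rule: span_induct_alt) (auto simp: distrib_right scale_mult_left right)
  then have "e * e = e" using e(1) .
  moreover have "e \<in> span (ring_pow a ` {1..})"
    using e(1) mono[OF n1] by (auto simp: W_def)
  moreover have "e * ring_pow a m = ring_pow a m" if "m \<ge> n" for m
    using comm[OF e(1), of m] right[OF that] that n1 by simp
  ultimately show ?thesis using that by blast
qed

text \<open>
  The idempotent \<open>e\<close> attached to \<open>a\<close> lies in \<open>V\<close>, hence in \<open>I\<close>; so do the high powers
  \<open>a\<^sup>m = e * a\<^sup>m\<close> and all their multiples.
\<close>

lemma mathieu_subspace_if_idempotents_in_ideal:
  assumes V: "subspace V" and I: "sided_ideal scale Two_Sided I" "I \<subseteq> V"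
    and idem: "\<And>e. e \<in> V \<Longrightarrow> e * e = e \<Longrightarrow> e \<in> I"
  shows "mathieu_subspace scale \<theta> V"
proof -
  have left: "b * x \<in> I" and right: "x * c \<in> I" if "x \<in> I" for b c x
    using I(1) that by (auto simp: sided_ideal_def)
  have ev: "\<forall>\<^sub>F m in sequentially. ring_pow a m \<in> I" if a: "\<forall>m\<ge>1. ring_pow a m \<in> V" for a
  proof -
    obtain e n where e: "e \<in> span (ring_pow a ` {1..})" "e * e = e"
        "\<And>m. m \<ge> n \<Longrightarrow> e * ring_pow a m = ring_pow a m"
      using powers_eventual_unit[of a] by metis
    have "span (ring_pow a ` {1..}) \<subseteq> V"
      using a V by (intro span_minimal) auto
    then have "e \<in> I" using e idem by blast
    then have "ring_pow a m \<in> I" if "m \<ge> n" for m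
      using e(3)[OF that] right by metis
    then show ?thesis by (auto simp: eventually_sequentially)
  qed
  have "\<forall>\<^sub>F m in sequentially. b * ring_pow a m \<in> V"
      "\<forall>\<^sub>F m in sequentially. ring_pow a m * c \<in> V"
      "\<forall>\<^sub>F m in sequentially. b * ring_pow a m * c \<in> V"
    if "\<forall>m\<ge>1. ring_pow a m \<in> V" for a b c
    by (rule eventually_mono[OF ev[OF that]], use I(2) left right in blast)+
  then show ?thesis
    using V by (auto simp: mathieu_subspace_def split: side.split)
qed

lemma mathieu_subspace_if_only_trivial_idempotent:
  assumes "subspace V" and "\<And>e. e \<in> V \<Longrightarrow> e * e = e \<Longrightarrow> e = 0"
  shows "mathieu_subspace scale \<theta> V"
  using assms
  by (intro mathieu_subspace_if_idempotents_in_ideal[where I = "{0}"])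
     (auto simp: sided_ideal_def subspace_0)

lemma mathieu_subspace_range:
  assumes \<delta>: "derivation scale \<delta> \<or> E_derivation scale \<delta>"
  shows "mathieu_subspace scale \<theta> (range \<delta>)"
proof -
  have sub: "subspace (range \<delta>)"
    using \<delta> pair.linear_subspace_image[OF _ subspace_UNIV]
    by (auto simp: derivation_def E_derivation_def)
  show ?thesis
  proof (cases "derivation scale \<delta>")
    case True
    then show ?thesis
      by (intro mathieu_subspace_if_only_trivial_idempotent[OF sub] derivation_idempotent_in_range_eq_0)
  next
    case False
    then have E: "E_derivation scale \<delta>" using \<delta> by simp
    obtain N where "\<And>y. ((\<lambda>y. y - \<delta> y) ^^ Suc N) y = 0 \<Longrightarrow> ((\<lambda>y. y - \<delta> y) ^^ N) y = 0"
      using kernel_funpow_stabilizes[OF E_derivation_endomorphism(1)[OF E]] by metis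
    then show ?thesis
      using E_derivation_idempotent_in_kernel_funpow[OF E]
      by (intro mathieu_subspace_if_idempotents_in_ideal[OF sub kernel_funpow_ideal[OF E, of N]
            kernel_funpow_subset_range[OF E]]) auto
  qed
qed

text \<open>
  The case of interest is an \<open>\<E>\<close>-derivation. A fixed point of the locally nilpotent \<open>\<delta>\<close> is zero, that is, \<open>id - \<delta>\<close> is
  injective, and the kernels of its powers are constant from \<open>N = 0\<close> on.
\<close>

lemma locally_nilpotent_idempotent_in_range_eq_0:
  assumes \<delta>: "derivation scale \<delta> \<or> E_derivation scale \<delta>" and nil: "locally_nilpotent \<delta>"
    and e: "e \<in> range \<delta>" "e * e = e"
  shows "e = 0"
proof (cases "derivation scale \<delta>")
  case True
  then show ?thesis using e by (rule derivation_idempotent_in_range_eq_0)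
next
  case False
  then have E: "E_derivation scale \<delta>" using \<delta> by simp
  have inj: "y = 0" if "y - \<delta> y = 0" for y
  proof -
    have "(\<delta> ^^ m) y = y" for m
      using that by (induction m) simp_all
    then show ?thesis using nil by (metis locally_nilpotent_def)
  qed
  have "((\<lambda>y. y - \<delta> y) ^^ 0) e = 0"
    by (rule E_derivation_idempotent_in_kernel_funpow[OF E e]) (use inj in simp)
  then show ?thesis by simp
qed

lemma mathieu_subspace_image_if_locally_nilpotent:
  assumes \<delta>: "derivation scale \<delta> \<or> E_derivation scale \<delta>" and nil: "locally_nilpotent \<delta>"
    and J: "subspace J"
  shows "mathieu_subspace scale \<theta> (\<delta> ` J)"
proof (rule mathieu_subspace_if_only_trivial_idempotent)
  show "subspace (\<delta> ` J)"
    using \<delta> pair.linear_subspace_image[OF _ J]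
    by (auto simp: derivation_def E_derivation_def)
  show "e = 0" if "e \<in> \<delta> ` J" "e * e = e" for e
    using locally_nilpotent_idempotent_in_range_eq_0[OF \<delta> nil] that by blast
qed

end

theorem proposition2p4:
  fixes scale :: "'k::field_char_0 \<Rightarrow> 'a::ring \<Rightarrow> 'a"
  assumes "algebra_over scale"
    and "findim scale (UNIV :: 'a set)"
  shows "(\<forall>\<delta>. (derivation scale \<delta> \<or> E_derivation scale \<delta>) \<and> locally_finite scale \<delta> \<longrightarrow>
            mathieu_subspace scale Two_Sided (range \<delta>)) \<and>
         (\<forall>\<delta>. (derivation scale \<delta> \<or> E_derivation scale \<delta>) \<and> locally_nilpotent \<delta> \<longrightarrow>
            (\<forall>\<theta> J. sided_ideal scale \<theta> J \<longrightarrow> mathieu_subspace scale \<theta> (\<delta> ` J)))"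
proof -
  interpret findim_algebra scale
    using assms by (simp add: findim_algebra_def findim_algebra_axioms_def)
  show ?thesis
    using mathieu_subspace_range mathieu_subspace_image_if_locally_nilpotent
    by (auto simp: sided_ideal_def)
qed

end
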